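(* Let $\{x^k\}_{k\ge0}$ be a monotone randomized algorithm (MRA) with data $(S,g,h,c_1,c_2,c_3,\{\alpha_k\})$, suppose the stepsize condition holds, and suppose the local error bound condition holds with moduli $\phi_{\bar x}$, $\bar x\in F:=g^{-1}(\{0\})\cap S$. Assume that $1/\sqrt{\phi_{\bar x}}$ is integrable near $0$ for all $\bar x\in F$. Let $$E_0=\Big\{\omega:\ g(x^k)\to0,\ \liminf_{k\to\infty}\frac{\sum_{i=1}^k\alpha_iz_i}{\sum_{i=1}^k\alpha_i}\ge c_2\Big\},\qquad E_1=\{\omega:\ \{x^k\}_{k\ge 0}\text{ is bounded}\}.$$ Then there exists a random variable $x^*$ such that, on $E_0\cap E_1$, $x^*\in F$ and $x^k\to x^*$. Moreover, for every $\omega\in E_0\cap E_1$: (i) If $1/\phi_{x^*(\omega)}$ is integrable near $0$, then the sequence $\{x^k(\omega)\}_{k\ge0}$ terminates in finitely many iterations, i.e., there is $K(\omega)\in\mathbb N$ with $x^k(\omega)=x^{K(\omega)}(\omega)$ for all $k\ge K(\omega)$. (ii) If $1/\phi_{x^*(\omega)}$ is not integrable near $0$, then there exists a positive integer $K_4(\omega)$ such that for all $k\ge K_4(\omega)$, $$h(x^k(\omega))-h^\infty(\omega)\le\Psi_{x^*(\omega)}^{-1}\Big(\frac{c_1c_2}{2}A_k\Big)$$ and $$\|x^k(\omega)-x^*(\omega)\|\le\frac{\sqrt2}{c_1\sqrt{c_2}}\,\Phi_{x^*(\omega)}\Big(\Psi_{x^*(\omega)}^{-1}\Big(\frac{c_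1c_2}{2}A_k\Big)\Big).$$
   Context: MRA. $(\Omega,\mathcal F,\{\mathcal F_k\}_{k\ge0},\mathbb P)$ is a filtered probability space and $\{x^k\}_{k\ge0}$ is a sequence of random vectors in $\mathbb R^d$ adapted to $\{\mathcal F_k\}$, with deterministic $x^0$. It is a monotone randomized algorithm (MRA) if there are a closed set $S\subseteq\mathbb R^d$, continuous functions $g,h:S\to\mathbb R$ with $g\ge0$ and $h^*:=\inf_{x\in S}h(x)>-\infty$, constants $c_1,c_2,c_3>0$ with $c_3\ge c_2$, and a positive (deterministic) sequence $\{\alpha_k\}_{k\ge0}$ such that for all $k\ge0$: $x^k\in S$; $h(x^{k+1})\le h(x^k)-\frac{c_1}{\alpha_k}\|x^{k+1}-x^k\|^2$; $\mathbb E[\|x^{k+1}-x^k\|^2\mid\mathcal F_k]\ge c_2\alpha_k^2g(x^k)$ almost surely; $\|x^{k+1}-x^k\|^2\le c_3\alpha_k^2g(x^k)$. Random variables $z_k$: $z_k:=\frac{\|x^{k+1}-x^k\|^2}{\alpha_k^2g(x^k)}$ if $g(x^k)>0$, and $z_k:=c_2$ if $g(x^k)=0$. Stepsize condition. There is $\bar\alpha>0$ with $0<\alpha_k\le\bar\alpha$ for all $k$, and $\sum_{k=0}^\infty\alpha_k=+\infty$. $A_k:=\sum_{i=0}^{k-1}\alpha_i$. Local error bound condition. For every $\bar x\in F$ there are $\eta_{\bar x}>0$, $\delta_{\bar x}>0$ and a function $\phi_{\bar x}:[0,\eta_{\bar x})\to\mathbb R_+$, non-decreasing and strictly positive on $(0,\eta_{\bar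 x})$ with $\phi_{\bar x}(0)=0$, such that $\phi_{\bar x}(h(x)-h(\bar x))\le g(x)$ for all $x\in S$ with $\|x-\bar x\|<\delta_{\bar x}$ and $h(\bar x)<h(x)<h(\bar x)+\eta_{\bar x}$. Notation. $h^\infty(\omega):=\lim_{k\to\infty}h(x^k(\omega))$ (the limit exists by monotonicity). A function $[0,\eta)\to[0,+\infty]$ is integrable near $0$ if it is integrable on $[0,\eta']$ for some $\eta'\in(0,\eta)$. For each $\bar x\in F$, fix any $t_0\in(0,\eta_{\bar x})$; $\Psi_{\bar x}(t):=\int_t^{t_0}\frac{ds}{\phi_{\bar x}(s)}$ and $\Phi_{\bar x}(t):=\int_0^t\frac{ds}{\sqrt{\phi_{\bar x}(s)}}$ for $t\in[0,\eta_{\bar x})$. $\Psi_{\bar x}$ is strictly decreasing; when $1/\phi_{\bar x}$ is not integrable near $0$, $\Psi_{\bar x}(0)=+\infty$ and $\Psi_{\bar x}^{-1}$ is defined on $(\lim_{t\uparrow\eta_{\bar x}}\Psi_{\bar x}(t),+\infty]$. *)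

theory Defs
  imports "HOL-Probability.Probability"
begin

text \<open>
  The functions \<open>g\<close> and \<open>h\<close> live on \<open>S\<close>; they are modelled as total functions of which only the
  values on \<open>S\<close> are constrained. Apart from the conditional-expectation bound, the requirements
  on the iterates hold surely, i.e. at every outcome. Since \<open>x 0\<close> is deterministic and \<open>h\<close> is bounded
  below, the squared step lengths are bounded, so \<^const>\<open>real_cond_exp\<close> is applied to an
  integrable function.
\<close>

locale monotone_randomized_algorithm =
  prob_space M + filtration "space M" \<F>
  for M :: "'w measure" and \<F> :: "nat \<Rightarrow> 'w measure" +
  fixes x :: "nat \<Rightarrow> 'w \<Rightarrow> real ^ 'd"
    and S :: "(real ^ 'd) set"
    and g h :: "real ^ 'd \<Rightarrow> real"
    and c1 c2 c3 :: real
    and \<alpha> :: "nat \<Rightarrow> real"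
  assumes subalg: "\<And>k. subalgebra M (\<F> k)"
    and adapted: "\<And>k. x k \<in> borel_measurable (\<F> k)"
    and x0_deterministic: "\<exists>x0. \<forall>\<omega>\<in>space M. x 0 \<omega> = x0"
    and closed_S: "closed S"
    and cont_g: "continuous_on S g"
    and cont_h: "continuous_on S h"
    and g_nonneg: "\<And>y. y \<in> S \<Longrightarrow> g y \<ge> 0"
    and h_bdd_below: "bdd_below (h ` S)"
    and c_pos: "c1 > 0" "c2 > 0" "c3 > 0"
    and c2_le_c3: "c2 \<le> c3"
    and \<alpha>_pos: "\<And>k. \<alpha> k > 0"
    and x_in_S: "\<And>k \<omega>. \<omega> \<in> space M \<Longrightarrow> x k \<omega> \<in> S"
    and descent: "\<And>k \<omega>. \<omega> \<in> space M \<Longrightarrow>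
      h (x (Suc k) \<omega>) \<le> h (x k \<omega>) - c1 / \<alpha> k * (norm (x (Suc k) \<omega> - x k \<omega>))\<^sup>2"
    and step_lower: "\<And>k. AE \<omega> in M.
      real_cond_exp M (\<F> k) (\<lambda>\<omega>'. (norm (x (Suc k) \<omega>' - x k \<omega>'))\<^sup>2) \<omega>
        \<ge> c2 * (\<alpha> k)\<^sup>2 * g (x k \<omega>)"
    and step_upper: "\<And>k \<omega>. \<omega> \<in> space M \<Longrightarrow>
      (norm (x (Suc k) \<omega> - x k \<omega>))\<^sup>2 \<le> c3 * (\<alpha> k)\<^sup>2 * g (x k \<omega>)"

definition zero_set :: "(real ^ 'd) set \<Rightarrow> (real ^ 'd \<Rightarrow> real) \<Rightarrow> (real ^ 'd) set" where
  "zero_set S g = {y \<in> S. g y = 0}"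

definition step_ratio ::
  "(nat \<Rightarrow> 'w \<Rightarrow> real ^ 'd) \<Rightarrow> (real ^ 'd \<Rightarrow> real) \<Rightarrow> real \<Rightarrow> (nat \<Rightarrow> real) \<Rightarrow> nat \<Rightarrow> 'w \<Rightarrow> real" where
  "step_ratio x g c2 \<alpha> k \<omega> =
     (if g (x k \<omega>) > 0
      then (norm (x (Suc k) \<omega> - x k \<omega>))\<^sup>2 / ((\<alpha> k)\<^sup>2 * g (x k \<omega>))
      else c2)"

definition stepsize_sum :: "(nat \<Rightarrow> real) \<Rightarrow> nat \<Rightarrow> real" where
  "stepsize_sum \<alpha> k = (\<Sum>i<k. \<alpha> i)"

definition stepsize_condition :: "(nat \<Rightarrow> real) \<Rightarrow> bool" where
  "stepsize_condition \<alpha> \<longleftrightarrow>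
     (\<exists>b>0. \<forall>k. 0 < \<alpha> k \<and> \<alpha> k \<le> b) \<and> filterlim (stepsize_sum \<alpha>) at_top sequentially"

text \<open>
  \<open>\<phi> y\<close> is relevant only on \<open>[0, \<eta> y)\<close>; its values elsewhere are unconstrained and unused.
\<close>

definition local_error_bound ::
  "(real ^ 'd) set \<Rightarrow> (real ^ 'd \<Rightarrow> real) \<Rightarrow> (real ^ 'd \<Rightarrow> real) \<Rightarrow>
   (real ^ 'd \<Rightarrow> real) \<Rightarrow> (real ^ 'd \<Rightarrow> real \<Rightarrow> real) \<Rightarrow> bool" where
  "local_error_bound S g h \<eta> \<phi> \<longleftrightarrow>
     (\<forall>y\<in>zero_set S g.
        \<eta> y > 0 \<and> \<phi> y 0 = 0 \<and>
        (\<forall>t\<in>{0<..<\<eta> y}. \<phi> y t > 0) \<and> mono_on {0<..<\<eta> y} (\<phi> y) \<and>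
        (\<exists>\<delta>>0. \<forall>u\<in>S. norm (u - y) < \<delta> \<and> h y < h u \<and> h u < h y + \<eta> y \<longrightarrow>
           \<phi> y (h u - h y) \<le> g u))"

text \<open>
  Below, \<open>1 / \<phi> 0\<close> and \<open>1 / sqrt (\<phi> 0)\<close> evaluate to \<open>0\<close> instead of \<open>\<infinity>\<close>; this affects the
  integrands at a single point only and hence no integral.
\<close>

definition integrable_near_0 :: "real \<Rightarrow> (real \<Rightarrow> real) \<Rightarrow> bool" where
  "integrable_near_0 \<eta> f \<longleftrightarrow> (\<exists>\<eta>'\<in>{0<..<\<eta>}. set_integrable lborel {0..\<eta>'} f)"

text \<open>
  The oriented integral of \<open>1 / \<phi>\<close> from \<open>t\<close> to \<open>t0\<close>, extended-real valued so that its value at \<open>0\<close>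
  is \<open>\<infinity>\<close> when \<open>1 / \<phi>\<close> is not integrable near \<open>0\<close>.
\<close>

definition Psi :: "(real \<Rightarrow> real) \<Rightarrow> real \<Rightarrow> real \<Rightarrow> ereal" where
  "Psi \<phi> t0 t =
     (if t \<le> t0 then enn2ereal (\<integral>\<^sup>+ s\<in>{t..t0}. ennreal (1 / \<phi> s) \<partial>lborel)
      else - enn2ereal (\<integral>\<^sup>+ s\<in>{t0..t}. ennreal (1 / \<phi> s) \<partial>lborel))"

text \<open>
  The inverse of \<open>Psi \<phi> t0\<close> on \<open>[0, \<eta>)\<close>, meaningful on the image of that interval.
  When \<open>1 / \<phi>\<close> is not integrable near \<open>0\<close>, the image contains all sufficiently large reals.
\<close>

definition Psi_inv :: "real \<Rightarrow> (real \<Rightarrow> real) \<Rightarrow> real \<Rightarrow> ereal \<Rightarrow> real" where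
  "Psi_inv \<eta> \<phi> t0 = inv_into {0..<\<eta>} (Psi \<phi> t0)"

definition Phi :: "(real \<Rightarrow> real) \<Rightarrow> real \<Rightarrow> real" where
  "Phi \<phi> t = set_lebesgue_integral lborel {0..t} (\<lambda>s. 1 / sqrt (\<phi> s))"

definition event_E0 ::
  "'w measure \<Rightarrow> (nat \<Rightarrow> 'w \<Rightarrow> real ^ 'd) \<Rightarrow> (real ^ 'd \<Rightarrow> real) \<Rightarrow> real \<Rightarrow> (nat \<Rightarrow> real) \<Rightarrow> 'w set" where
  "event_E0 M x g c2 \<alpha> =
     {\<omega> \<in> space M. (\<lambda>k. g (x k \<omega>)) \<longlonglongrightarrow> 0 \<and>
        liminf (\<lambda>k. ereal ((\<Sum>i=1..k. \<alpha> i * step_ratio x g c2 \<alpha> i \<omega>) / (\<Sum>i=1..k. \<alpha> i)))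
          \<ge> ereal c2}"

definition event_E1 :: "'w measure \<Rightarrow> (nat \<Rightarrow> 'w \<Rightarrow> real ^ 'd) \<Rightarrow> 'w set" where
  "event_E1 M x = {\<omega> \<in> space M. bounded (range (\<lambda>k. x k \<omega>))}"

definition h_limit :: "(nat \<Rightarrow> 'w \<Rightarrow> real ^ 'd) \<Rightarrow> (real ^ 'd \<Rightarrow> real) \<Rightarrow> 'w \<Rightarrow> real" where
  "h_limit x h \<omega> = lim (\<lambda>k. h (x k \<omega>))"

end

theory Submission
  imports Defs
begin

text \<open>
  Fix an outcome and put \<open>u\<^sub>k = h (x\<^sub>k) - h\<^sup>\<infinity>\<close>, \<open>c = c\<^sub>1 c\<^sub>2 / 2\<close>. If some \<open>u\<^sub>k\<close> vanishes, the
  trajectory is constant from there on. Otherwise let \<open>\<phi>\<close> be a modulus with \<open>\<phi> (u\<^sub>k) \<le> g (x\<^sub>k)\<close>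
  eventually. Each step increases \<open>\<Psi> (u\<^sub>k)\<close> by at least \<open>c\<^sub>1 \<alpha>\<^sub>k z\<^sub>k\<close>, so the averaged bound on \<open>z\<close> and the
  boundedness of \<open>\<alpha>\<close> give \<open>\<Psi> (u\<^sub>k) \<ge> c A\<^bsub>k+1\<^esub>\<close> eventually, which is impossible if \<open>1 / \<phi>\<close> is
  integrable near \<open>0\<close>. With \<open>\<Psi> (\<rho>\<^sub>k) = c A\<^sub>k\<close> this says \<open>u\<^sub>k \<le> \<rho>\<^bsub>k+1\<^esub>\<close>. Since individual \<open>z\<^sub>k\<close> may be
  small, step lengths are bounded by the geometric mean of the decrements of \<open>\<Phi> (u\<^sub>k)\<close> and
  \<open>\<Phi> (\<rho>\<^sub>k)\<close>; the arithmetic mean telescopes and bounds the remaining path length by a multiple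
  of \<open>\<Phi> (\<rho>\<^sub>k)\<close>.

  This is used twice: first with the minimum of finitely many moduli, belonging to a finite
  subcover of the compact set of possible limit points, to obtain convergence, and then with the
  modulus of the limit, to obtain the rates.
\<close>

section \<open>Integrals of \<open>1 / \<phi>\<close> and \<open>1 / sqrt \<phi>\<close>, and the
  functions they define\<close>

lemma set_integrable_Icc_bounded:
  fixes f :: "real \<Rightarrow> real"
  assumes m: "set_borel_measurable borel {a..b} f"
    and f: "\<And>s. s \<in> {a..b} \<Longrightarrow> \<bar>f s\<bar> \<le> B"
  shows "set_integrable lborel {a..b} f"
proof -
  \<comment> \<open>The indicator occurs twice because only the truncated function is known to be
    Borel measurable, so the truncation serves as the integrand.\<close>
  have "integrable lborel (\<lambda>s. indicator {a..b} s *\<^sub>R (indicator {a..b} s *\<^sub>R f s))"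
    using m f
    by (intro integrableI_bounded_set_indicator[where B = B])
      (auto simp: set_borel_measurable_def emeasure_lborel_Icc_eq)
  moreover have "(\<lambda>s. indicator {a..b} s *\<^sub>R (indicator {a..b} s *\<^sub>R f s))
      = (\<lambda>s. indicator {a..b} s *\<^sub>R f s)"
    by (auto simp: indicator_def)
  ultimately show ?thesis
    by (simp add: set_integrable_def)
qed

text \<open>The modulus is detached from the points of the zero set, so that the same theory covers
  each \<open>\<phi> y\<close> and pointwise minima of several of them.\<close>

locale error_modulus =
  fixes \<eta> :: real and \<phi> :: "real \<Rightarrow> real" and t0 :: real
  assumes zero: "\<phi> 0 = 0"
    and pos: "\<And>t. 0 < t \<Longrightarrow> t < \<eta> \<Longrightarrow> 0 < \<phi> t"
    and mono: "mono_on {0<..<\<eta>} \<phi>"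
    and t0: "0 < t0" "t0 < \<eta>"
    and integrable_sqrt: "integrable_near_0 \<eta> (\<lambda>s. 1 / sqrt (\<phi> s))"
begin

lemma le: "0 < a \<Longrightarrow> a \<le> b \<Longrightarrow> b < \<eta> \<Longrightarrow> \<phi> a \<le> \<phi> b"
  using mono by (auto simp: mono_on_def)

lemma nonneg: "0 \<le> t \<Longrightarrow> t < \<eta> \<Longrightarrow> 0 \<le> \<phi> t"
  using pos[of t] zero by (cases "t = 0") auto

text \<open>Monotonicity gives measurability on \<open>{0<..<\<eta>}\<close>. The point 0 lies
  outside this interval; there the composition vanishes, since \<open>\<phi> 0 = 0\<close> and
  \<open>f 0 = 0\<close>.\<close>

lemma measurable_comp:
  assumes f: "f \<in> borel_measurable borel" "f 0 = (0::real)" and b: "b < \<eta>" "0 \<le> a"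
  shows "set_borel_measurable borel {a..b} (\<lambda>s. f (\<phi> s))"
proof -
  let ?I = "{0<..<\<eta>}"
  have "\<phi> \<in> borel_measurable (restrict_space borel ?I)"
    using mono by (rule borel_measurable_mono_on_fnc)
  then have "(\<lambda>s. f (\<phi> s)) \<in> borel_measurable (restrict_space borel ?I)"
    using f(1) by (rule measurable_compose)
  then have m: "(\<lambda>s. indicator ?I s *\<^sub>R f (\<phi> s)) \<in> borel_measurable borel"
    by (subst (asm) borel_measurable_restrict_space_iff) auto
  have "(\<lambda>s. indicator {a..b} s *\<^sub>R f (\<phi> s))
      = (\<lambda>s. indicator {a..b} s *\<^sub>R (indicator ?I s *\<^sub>R f (\<phi> s)))"
  proof
    fix s
    show "indicator {a..b} s *\<^sub>R f (\<phi> s)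
        = indicator {a..b} s *\<^sub>R (indicator ?I s *\<^sub>R f (\<phi> s))"
      using b f(2) zero by (cases "s = 0") (auto simp: indicator_def)
  qed
  moreover have "\<dots> \<in> borel_measurable borel"
    using m by measurable
  ultimately show ?thesis
    by (simp add: set_borel_measurable_def)
qed

lemma measurable_inverse:
  assumes "b < \<eta>" "0 \<le> a"
  shows "set_borel_measurable borel {a..b} (\<lambda>s. 1 / \<phi> s)"
    and "set_borel_measurable borel {a..b} (\<lambda>s. 1 / sqrt (\<phi> s))"
  \<comment> \<open>Division by zero yields 0, so both choices of \<open>f\<close> vanish at
    0.\<close>
  using measurable_comp[of "\<lambda>y. 1 / y" b a] measurable_comp[of "\<lambda>y. 1 / sqrt y" b a] assms
  by auto

text \<open>Away from 0 the integrands are bounded by their values at the left endpoint.\<close>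

lemma integrable_inverse:
  assumes "0 < a" "b < \<eta>"
  shows "set_integrable lborel {a..b} (\<lambda>s. 1 / \<phi> s)"
    and "set_integrable lborel {a..b} (\<lambda>s. 1 / sqrt (\<phi> s))"
proof -
  have p: "0 < \<phi> a \<and> \<phi> a \<le> \<phi> s" if "s \<in> {a..b}" for s
    using that assms pos[of a] le[of a s] by auto
  show "set_integrable lborel {a..b} (\<lambda>s. 1 / \<phi> s)"
  proof (rule set_integrable_Icc_bounded[OF measurable_inverse(1)])
    show "\<bar>1 / \<phi> s\<bar> \<le> 1 / \<phi> a" if "s \<in> {a..b}" for s
      using p[OF that] by (auto simp: frac_le)
  qed (use assms in auto)
  show "set_integrable lborel {a..b} (\<lambda>s. 1 / sqrt (\<phi> s))"
  proof (rule set_integrable_Icc_bounded[OF measurable_inverse(2)])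
    show "\<bar>1 / sqrt (\<phi> s)\<bar> \<le> 1 / sqrt (\<phi> a)" if "s \<in> {a..b}" for s
      using p[OF that] by (auto simp: frac_le)
  qed (use assms in auto)
qed

lemma integrable_inverse_sqrt:
  assumes "b < \<eta>"
  shows "set_integrable lborel {0..b} (\<lambda>s. 1 / sqrt (\<phi> s))"
proof -
  obtain e where e: "0 < e" "e < \<eta>" "set_integrable lborel {0..e} (\<lambda>s. 1 / sqrt (\<phi> s))"
    using integrable_sqrt by (auto simp: integrable_near_0_def)
  have "set_integrable lborel ({0..e} \<union> {e..b}) (\<lambda>s. 1 / sqrt (\<phi> s))"
    using e integrable_inverse(2)[OF e(1) assms] by (intro set_integrable_Un) auto
  then show ?thesis
    by (rule set_integrable_subset) auto
qed

lemmas HK_inverse = set_borel_integral_eq_integral(1)[OF integrable_inverse(1)]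
lemmas HK_inverse_sqrt = set_borel_integral_eq_integral(1)[OF integrable_inverse(2)]

text \<open>Real-valued counterpart of \<open>Psi\<close> on \<open>{0<..<\<eta>}\<close>, written
  with the Henstock-Kurzweil integral so that estimates avoid extended reals;
  \<open>Psi_eq_psi\<close> identifies the two.\<close>

definition psi :: "real \<Rightarrow> real" where
  "psi t = (if t \<le> t0 then integral {t..t0} (\<lambda>s. 1 / \<phi> s)
            else - integral {t0..t} (\<lambda>s. 1 / \<phi> s))"

lemma psi_diff:
  assumes "0 < a" "a \<le> b" "b < \<eta>"
  shows "psi a - psi b = integral {a..b} (\<lambda>s. 1 / \<phi> s)"
proof -
  note c = Henstock_Kurzweil_Integration.integral_combine[OF _ _ HK_inverse]
  consider "b \<le> t0" | "a \<le> t0" "t0 < b" | "t0 < a"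
    by linarith
  then show ?thesis
    by cases (use assms t0 c[of a b t0] c[of a t0 b] c[of t0 a b] in \<open>auto simp: psi_def\<close>)
qed

lemma inverse_integral_ge:
  assumes "0 < a" "a \<le> b" "b < \<eta>"
  shows "(b - a) / \<phi> b \<le> integral {a..b} (\<lambda>s. 1 / \<phi> s)"
proof -
  have "integral {a..b} (\<lambda>s. 1 / \<phi> b) \<le> integral {a..b} (\<lambda>s. 1 / \<phi> s)"
    using assms by (intro integral_le HK_inverse) (auto intro!: frac_le le pos)
  then show ?thesis
    using assms by simp
qed

text \<open>Since \<open>1 / \<phi>\<close> is smallest at the right endpoint, a decrease of the
  argument forces a proportional increase of \<open>psi\<close>.\<close>

lemma psi_diff_ge:
  assumes "0 < a" "a \<le> b" "b < \<eta>"
  shows "(b - a) / \<phi> b \<le> psi a - psi b"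
  using psi_diff[OF assms] inverse_integral_ge[OF assms] by simp

lemma psi_strict_antimono:
  assumes "0 < a" "a < b" "b < \<eta>"
  shows "psi b < psi a"
proof -
  have "0 < (b - a) / \<phi> b"
    using assms pos[of b] by simp
  then show ?thesis
    using psi_diff_ge[of a b] assms by linarith
qed

lemma psi_le_imp_ge:
  assumes "0 < a" "a < \<eta>" "0 < b" "b < \<eta>" "psi a \<le> psi b"
  shows "b \<le> a"
  using psi_strict_antimono[of a b] assms by (meson not_le)

lemma psi_t0: "psi t0 = 0"
  by (simp add: psi_def)

text \<open>This is the intermediate value theorem on \<open>{a..t0}\<close>. As \<open>psi\<close>
  decreases and \<open>psi t0 = 0\<close>, a nonnegative \<open>psi a\<close> forces
  \<open>a \<le> t0\<close>.\<close>

lemma psi_attains: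
  assumes "0 < a" "a < \<eta>" "0 \<le> y" "y \<le> psi a"
  obtains r where "0 < r" "r < \<eta>" "psi r = y"
proof (cases "a \<le> t0")
  case True
  have "continuous_on {a..t0} (\<lambda>s. integral {s..t0} (\<lambda>s. 1 / \<phi> s))"
    using assms t0 by (intro indefinite_integral_continuous_1' HK_inverse)
  then have "continuous_on {a..t0} psi"
    by (rule continuous_on_eq) (auto simp: psi_def)
  then obtain r where "a \<le> r" "r \<le> t0" "psi r = y"
    using IVT2'[of psi t0 y a] assms True psi_t0 by auto
  then show ?thesis
    using that[of r] assms t0 by auto
next
  case False
  then have "psi a < 0"
    using psi_strict_antimono[of t0 a] assms t0 psi_t0 by auto
  then show ?thesis
    using assms by linarith
qed

lemma Phi_eq: "b < \<eta> \<Longrightarrow> Phi \<phi> b = integral {0..b} (\<lambda>s. 1 / sqrt (\<phi> s))"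
  unfolding Phi_def by (intro set_borel_integral_eq_integral integrable_inverse_sqrt)

lemma Phi_nonneg: "b < \<eta> \<Longrightarrow> 0 \<le> Phi \<phi> b"
  unfolding Phi_def set_lebesgue_integral_def
  by (rule Bochner_Integration.integral_nonneg) (auto simp: indicator_def nonneg)

lemma Phi_diff:
  assumes "0 \<le> a" "a \<le> b" "b < \<eta>"
  shows "Phi \<phi> b - Phi \<phi> a = integral {a..b} (\<lambda>s. 1 / sqrt (\<phi> s))"
proof -
  have "integral {0..a} (\<lambda>s. 1 / sqrt (\<phi> s)) + integral {a..b} (\<lambda>s. 1 / sqrt (\<phi> s))
      = integral {0..b} (\<lambda>s. 1 / sqrt (\<phi> s))"
    using assms
    by (intro Henstock_Kurzweil_Integration.integral_combine
        set_borel_integral_eq_integral integrable_inverse_sqrt) auto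
  then show ?thesis
    using assms by (simp add: Phi_eq)
qed

text \<open>The first bound uses the value of the integrand at \<open>b\<close>. For the second, the
  integrand is written as \<open>sqrt \<phi> * (1 / \<phi>)\<close> and the first factor is bounded
  below by its value at \<open>a\<close>. \<open>step_length_le\<close> multiplies the two bounds,
  taken on different intervals.\<close>

lemma Phi_diff_ge:
  assumes "0 < a" "a \<le> b" "b < \<eta>"
  shows "(b - a) / sqrt (\<phi> b) \<le> Phi \<phi> b - Phi \<phi> a"
    and "sqrt (\<phi> a) * (psi a - psi b) \<le> Phi \<phi> b - Phi \<phi> a"
proof -
  have d: "Phi \<phi> b - Phi \<phi> a = integral {a..b} (\<lambda>s. 1 / sqrt (\<phi> s))"
    using Phi_diff assms by simp
  have "integral {a..b} (\<lambda>s. 1 / sqrt (\<phi> b)) \<le> integral {a..b} (\<lambda>s. 1 / sqrt (\<phi> s))"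
    using assms by (intro integral_le HK_inverse_sqrt) (auto intro!: frac_le le pos)
  then show "(b - a) / sqrt (\<phi> b) \<le> Phi \<phi> b - Phi \<phi> a"
    using assms d by simp
  have "integral {a..b} (\<lambda>s. sqrt (\<phi> a) * (1 / \<phi> s)) \<le> integral {a..b} (\<lambda>s. 1 / sqrt (\<phi> s))"
  proof (intro integral_le HK_inverse_sqrt integrable_on_mult_right HK_inverse)
    fix s assume s: "s \<in> {a..b}"
    then have p: "0 < \<phi> s" "sqrt (\<phi> a) \<le> sqrt (\<phi> s)"
      using assms pos[of s] le[of a s] by auto
    then have "sqrt (\<phi> a) * (1 / \<phi> s) \<le> sqrt (\<phi> s) * (1 / \<phi> s)"
      by (intro mult_right_mono) auto
    also have "\<dots> = 1 / sqrt (\<phi> s)"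
      using p by (simp add: field_simps)
    finally show "sqrt (\<phi> a) * (1 / \<phi> s) \<le> 1 / sqrt (\<phi> s)" .
  qed (use assms in auto)
  then show "sqrt (\<phi> a) * (psi a - psi b) \<le> Phi \<phi> b - Phi \<phi> a"
    using d psi_diff[OF assms] by (simp only: integral_mult_right)
qed

lemma nn_integral_inverse:
  assumes "0 < a" "b < \<eta>"
  shows "(\<integral>\<^sup>+ s\<in>{a..b}. ennreal (1 / \<phi> s) \<partial>lborel) = ennreal (integral {a..b} (\<lambda>s. 1 / \<phi> s))"
proof (rule set_nn_integral_lborel_eq_integral)
  show "set_borel_measurable borel {a..b} (\<lambda>s. 1 / \<phi> s)"
    using assms measurable_inverse by simp
  show "0 \<le> 1 / \<phi> s" if "s \<in> {a..b}" for s
    using that assms nonneg[of s] by simp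
  have "(\<integral>\<^sup>+ s\<in>{a..b}. ennreal (1 / \<phi> s) \<partial>lborel)
      = (\<integral>\<^sup>+ s. ennreal (norm (indicator {a..b} s *\<^sub>R (1 / \<phi> s))) \<partial>lborel)"
    using assms nonneg by (intro nn_integral_cong) (auto simp: indicator_def)
  also have "\<dots> < \<infinity>"
    using integrable_inverse(1)[OF assms]
    by (simp add: set_integrable_def integrable_iff_bounded)
  finally show "(\<integral>\<^sup>+ s\<in>{a..b}. ennreal (1 / \<phi> s) \<partial>lborel) < \<infinity>" .
qed

lemma Psi_eq_psi:
  assumes "0 < t" "t < \<eta>"
  shows "Psi \<phi> t0 t = ereal (psi t)"
proof -
  have "0 \<le> integral {a..b} (\<lambda>s. 1 / \<phi> s)" if "0 < a" "b < \<eta>" for a b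
    using that nonneg by (intro integral_nonneg HK_inverse) auto
  then show ?thesis
    using assms t0 by (auto simp: Psi_def psi_def nn_integral_inverse enn2ereal_ennreal)
qed

text \<open>If \<open>1 / \<phi>\<close> is integrable on \<open>{0..e}\<close>, then
  \<open>psi\<close> exceeds \<open>psi e\<close> by at most that integral.\<close>

lemma psi_bounded:
  assumes "integrable_near_0 \<eta> (\<lambda>s. 1 / \<phi> s)"
  obtains B where "\<And>t. 0 < t \<Longrightarrow> t < \<eta> \<Longrightarrow> psi t \<le> B"
proof -
  obtain e where e: "0 < e" "e < \<eta>" "set_integrable lborel {0..e} (\<lambda>s. 1 / \<phi> s)"
    using assms by (auto simp: integrable_near_0_def)
  let ?I = "integral {0..e} (\<lambda>s. 1 / \<phi> s)"
  note i = set_borel_integral_eq_integral(1)[OF e(3)]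
  have I: "0 \<le> ?I"
    using i e nonneg by (intro integral_nonneg) auto
  have "psi t \<le> psi e + ?I" if t: "0 < t" "t < \<eta>" for t
  proof (cases "t \<le> e")
    case True
    have "integral {t..e} (\<lambda>s. 1 / \<phi> s) \<le> ?I"
      using t e i nonneg by (intro integral_subset_le i HK_inverse) auto
    then show ?thesis
      using psi_diff[of t e] t e True by simp
  next
    case False
    then show ?thesis
      using psi_strict_antimono[of e t] t e I by simp
  qed
  then show ?thesis
    by (rule that)
qed

lemma nn_integral_inverse_infinite:
  assumes "\<not> integrable_near_0 \<eta> (\<lambda>s. 1 / \<phi> s)"
  shows "(\<integral>\<^sup>+ s\<in>{0..t0}. ennreal (1 / \<phi> s) \<partial>lborel) = \<infinity>"
proof (rule ccontr)
  assume "\<not> ?thesis"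
  moreover have "(\<integral>\<^sup>+ s\<in>{0..t0}. ennreal (1 / \<phi> s) \<partial>lborel)
      = (\<integral>\<^sup>+ s. ennreal (indicator {0..t0} s *\<^sub>R (1 / \<phi> s)) \<partial>lborel)"
    by (intro nn_integral_cong) (auto simp: indicator_def)
  ultimately have fin: "(\<integral>\<^sup>+ s. ennreal (indicator {0..t0} s *\<^sub>R (1 / \<phi> s)) \<partial>lborel) < \<infinity>"
    by (simp add: less_top)
  have "integrable lborel (\<lambda>s. indicator {0..t0} s *\<^sub>R (1 / \<phi> s))"
    using measurable_inverse(1)[of t0 0] t0 fin nonneg
    by (intro integrableI_nonneg) (auto simp: set_borel_measurable_def indicator_def)
  then show False
    using assms t0 by (auto simp: integrable_near_0_def set_integrable_def)
qed

text \<open>By monotone convergence the integrals over \<open>{a n..t0}\<close> with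
  \<open>a n\<close> tending to 0 approach the infinite integral over \<open>{0..t0}\<close>, so the
  values \<open>psi (a n)\<close> have no common bound.\<close>

lemma psi_unbounded:
  assumes "\<not> integrable_near_0 \<eta> (\<lambda>s. 1 / \<phi> s)"
  obtains t where "0 < t" "t < \<eta>" "y \<le> psi t"
proof (rule ccontr)
  assume "\<not> thesis"
  with that have less: "psi t < y" if "0 < t" "t < \<eta>" for t
    using that by (meson not_le)
  define a where "a n = t0 / real (Suc n)" for n
  define f where "f n s = ennreal (1 / \<phi> s) * indicator {a n..t0} s" for n s
  have a: "0 < a n" "a n \<le> t0" for n
    using t0 by (auto simp: a_def field_simps)
  have "decseq a"
    using t0 by (auto simp: a_def decseq_def frac_le)
  have lim: "(\<lambda>n. integral\<^sup>N lborel (f n))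
      \<longlonglongrightarrow> (\<integral>\<^sup>+ s\<in>{0..t0}. ennreal (1 / \<phi> s) \<partial>lborel)"
  proof (rule nn_integral_LIMSEQ)
    show "incseq f"
      using \<open>decseq a\<close>
      by (force simp: incseq_def decseq_def le_fun_def f_def indicator_def intro: order_trans)
    show "f n \<in> borel_measurable lborel" for n
    proof -
      have "f n = (\<lambda>s. ennreal (indicator {a n..t0} s *\<^sub>R (1 / \<phi> s)))"
        by (auto simp: f_def indicator_def)
      then show ?thesis
        using measurable_inverse(1)[of t0 "a n"] a[of n] t0
        by (simp add: set_borel_measurable_def)
    qed
    show "(\<lambda>n. f n s) \<longlonglongrightarrow> ennreal (1 / \<phi> s) * indicator {0..t0} s" for s
    proof (cases "0 < s")
      case True
      have "a \<longlonglongrightarrow> 0"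
        unfolding a_def by (rule lim_const_over_n[THEN LIMSEQ_Suc])
      then have "\<forall>\<^sub>F n in sequentially. a n < s"
        using True by (rule order_tendstoD)
      then have "\<forall>\<^sub>F n in sequentially. f n s = ennreal (1 / \<phi> s) * indicator {0..t0} s"
        by eventually_elim (use True in \<open>auto simp: f_def indicator_def\<close>)
      then show ?thesis
        by (rule tendsto_eventually)
    next
      case False
      \<comment> \<open>The point 0 belongs to the limit interval but to no
        \<open>{a n..t0}\<close>; the default value of \<open>1 / \<phi> 0\<close> makes the two
        sides agree there.\<close>
      then have "ennreal (1 / \<phi> s) * indicator {0..t0} s = 0"
        using zero by (cases "s = 0") (auto simp: indicator_def)
      moreover have "f n s = 0" for n
        using False a[of n] by (auto simp: f_def indicator_def)
      ultimately show ?thesis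
        by (simp only: tendsto_const)
    qed
  qed
  have "integral\<^sup>N lborel (f n) \<le> ennreal y" for n
    using less[of "a n"] a[of n] t0 nn_integral_inverse[of "a n" t0]
    by (auto simp: f_def[abs_def] psi_def intro!: ennreal_leI)
  then have "(\<integral>\<^sup>+ s\<in>{0..t0}. ennreal (1 / \<phi> s) \<partial>lborel) \<le> ennreal y"
    using lim by (intro LIMSEQ_le_const2) auto
  then show False
    using nn_integral_inverse_infinite[OF assms] by (simp add: top_unique)
qed

text \<open>A finite level \<open>y\<close> is attained because \<open>psi\<close> is unbounded near
  0. The preimage chosen by \<open>inv_into\<close> cannot be 0, where \<open>Psi\<close> is
  infinite, so it lies where \<open>Psi\<close> and \<open>psi\<close> coincide.\<close>

lemma Psi_inv_eq:
  assumes "\<not> integrable_near_0 \<eta> (\<lambda>s. 1 / \<phi> s)" "0 \<le> y"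
  shows "0 < Psi_inv \<eta> \<phi> t0 (ereal y)" "Psi_inv \<eta> \<phi> t0 (ereal y) < \<eta>"
    and "psi (Psi_inv \<eta> \<phi> t0 (ereal y)) = y"
proof -
  obtain a where "0 < a" "a < \<eta>" "y \<le> psi a"
    using psi_unbounded[OF assms(1)] .
  then obtain r where r: "0 < r" "r < \<eta>" "psi r = y"
    using psi_attains assms(2) by metis
  let ?p = "Psi_inv \<eta> \<phi> t0 (ereal y)"
  have im: "ereal y \<in> Psi \<phi> t0 ` {0..<\<eta>}"
    using Psi_eq_psi[OF r(1,2)] r by (intro image_eqI[of _ _ r]) auto
  then have p: "?p \<in> {0..<\<eta>}" "Psi \<phi> t0 ?p = ereal y"
    unfolding Psi_inv_def by (auto intro!: inv_into_into f_inv_into_f simp del: atLeastLessThan_iff)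
  moreover have "Psi \<phi> t0 0 = \<infinity>"
    using t0 nn_integral_inverse_infinite[OF assms(1)] by (simp add: Psi_def)
  ultimately have "?p \<noteq> 0"
    by auto
  then show "0 < ?p" "?p < \<eta>"
    using p by auto
  then show "psi ?p = y"
    using p Psi_eq_psi by simp
qed

end

text \<open>Here \<open>u\<close>, \<open>v\<close> are consecutive gaps and \<open>r\<close>,
  \<open>r'\<close> consecutive comparison values. With \<open>w = sqrt (\<phi> r')\<close>, the
  product \<open>c * a * (u - v)\<close> splits into \<open>(u - v) / w\<close> and
  \<open>w * (c * a)\<close>, each at most a decrement of \<open>Phi\<close>. The inequality of
  arithmetic and geometric means then gives a sum that telescopes.\<close>

lemma (in error_modulus) step_length_le:
  fixes \<gamma> c a d :: real
  assumes v: "0 < v" "v \<le> u" "u \<le> r'" "r' \<le> r" "r < \<eta>"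
    and psi: "psi r' - psi r = c * a"
    and d: "0 \<le> d" "\<gamma> * d\<^sup>2 \<le> a * (u - v)"
    and pos': "0 < c" "0 < \<gamma>" "0 < a"
  shows "d * sqrt (c * \<gamma>) \<le> ((Phi \<phi> u - Phi \<phi> v) + (Phi \<phi> r - Phi \<phi> r')) / 2"
    (is "_ \<le> (?P + ?Q) / 2")
proof -
  \<comment> \<open>The point \<open>r'\<close> separates \<open>{v..u}\<close> from
    \<open>{r'..r}\<close>: \<open>\<phi> r'\<close> is an upper bound for \<open>\<phi>\<close> on
    the first interval and a lower bound on the second.\<close>
  let ?w = "sqrt (\<phi> r')"
  have w: "0 < ?w" "sqrt (\<phi> u) \<le> ?w" "0 < sqrt (\<phi> u)"
    using v pos le[of u r'] by auto
  have "(u - v) / ?w \<le> (u - v) / sqrt (\<phi> u)"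
    using w v by (intro divide_left_mono) auto
  also have "\<dots> \<le> ?P"
    using v by (intro Phi_diff_ge) auto
  finally have P: "(u - v) / ?w \<le> ?P" .
  have Q: "?w * (c * a) \<le> ?Q"
    using Phi_diff_ge(2)[of r' r] v psi by simp
  have nonneg: "0 \<le> ?P" "0 \<le> ?w * (c * a)" "0 \<le> ?Q"
  proof -
    have "0 \<le> (u - v) / ?w"
      using w v by simp
    then show "0 \<le> ?P"
      using P by (rule order_trans)
    show "0 \<le> ?w * (c * a)"
      using w pos' by simp
    then show "0 \<le> ?Q"
      using Q by (rule order_trans)
  qed
  have "(d * sqrt (c * \<gamma>))\<^sup>2 = c * (\<gamma> * d\<^sup>2)"
    using pos' by (simp add: power_mult_distrib)
  also have "\<dots> \<le> c * (a * (u - v))"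
    using d pos' by simp
  also have "\<dots> = ((u - v) / ?w) * (?w * (c * a))"
    using w by simp
  also have "\<dots> \<le> ?P * ?Q"
    using P Q nonneg by (intro mult_mono)
  also have "\<dots> \<le> ((?P + ?Q) / 2)\<^sup>2"
    using zero_le_power2[of "?P - ?Q"] by (simp add: power2_eq_square algebra_simps)
  finally show ?thesis
    by (rule power2_le_imp_le) (use nonneg in auto)
qed

section \<open>Deterministic trajectories\<close>

text \<open>A single outcome in the two events: probability has disappeared, and the lower bound on
  the step lengths survives only on average, through \<open>ratio\<close>.\<close>

locale descent_trajectory =
  fixes X :: "nat \<Rightarrow> real ^ 'd"
    and S :: "(real ^ 'd) set"
    and g h :: "real ^ 'd \<Rightarrow> real"
    and c1 c2 :: real
    and \<alpha> z :: "nat \<Rightarrow> real"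
    and b :: real
  assumes closed_S: "closed S"
    and cont_g: "continuous_on S g"
    and cont_h: "continuous_on S h"
    and h_bdd_below: "bdd_below (h ` S)"
    and c_pos: "c1 > 0" "c2 > 0"
    and \<alpha>_pos: "\<And>k. 0 < \<alpha> k"
    and \<alpha>_le: "\<And>k. \<alpha> k \<le> b"
    and \<alpha>_sum: "filterlim (stepsize_sum \<alpha>) at_top sequentially"
    and X_in_S: "\<And>k. X k \<in> S"
    and descent: "\<And>k. h (X (Suc k)) \<le> h (X k) - c1 / \<alpha> k * (norm (X (Suc k) - X k))\<^sup>2"
    and z_nonneg: "\<And>k. 0 \<le> z k"
    and step: "\<And>k. 0 < g (X k) \<Longrightarrow> (norm (X (Suc k) - X k))\<^sup>2 = (\<alpha> k)\<^sup>2 * g (X k) * z k"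
    and g_lim: "(\<lambda>k. g (X k)) \<longlonglongrightarrow> 0"
    and ratio: "ereal c2 \<le> liminf (\<lambda>k. ereal ((\<Sum>i=1..k. \<alpha> i * z i) / (\<Sum>i=1..k. \<alpha> i)))"
    and bounded_X: "bounded (range X)"
begin

definition h_inf :: real where "h_inf = lim (\<lambda>k. h (X k))"

definition gap :: "nat \<Rightarrow> real" where "gap k = h (X k) - h_inf"

lemma h_decseq: "decseq (\<lambda>k. h (X k))"
proof (rule decseq_SucI)
  fix k
  have "0 \<le> c1 / \<alpha> k * (norm (X (Suc k) - X k))\<^sup>2"
    using c_pos \<alpha>_pos[of k] by simp
  then show "h (X (Suc k)) \<le> h (X k)"
    using descent[of k] by linarith
qed

lemma h_lim: "(\<lambda>k. h (X k)) \<longlonglongrightarrow> h_inf"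
proof -
  obtain m where "\<And>k. m \<le> h (X k)"
    using h_bdd_below X_in_S by (auto simp: bdd_below_def)
  then obtain l where "(\<lambda>k. h (X k)) \<longlonglongrightarrow> l"
    using decseq_convergent[OF h_decseq] by metis
  then show ?thesis
    unfolding h_inf_def by (simp add: limI)
qed

lemma gap_nonneg: "0 \<le> gap k"
  using decseq_ge[OF h_decseq h_lim] by (simp add: gap_def)

lemma gap_antimono: "j \<le> k \<Longrightarrow> gap k \<le> gap j"
  using h_decseq by (simp add: gap_def decseq_def)

lemma gap_lim: "gap \<longlonglongrightarrow> 0"
  using tendsto_diff[OF h_lim tendsto_const[of h_inf]] by (simp add: gap_def[abs_def])

lemma step_le_gap: "c1 * (norm (X (Suc k) - X k))\<^sup>2 \<le> \<alpha> k * (gap k - gap (Suc k))"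
  using descent[of k] \<alpha>_pos[of k] by (simp add: gap_def field_simps)

text \<open>A zero gap stays zero, and by \<open>step_le_gap\<close> a step without decrease has
  length zero.\<close>

lemma stationary:
  assumes "gap K = 0" "K \<le> k"
  shows "gap k = 0" "X k = X K"
proof -
  have g0: "gap k = 0" if "K \<le> k" for k
    using gap_antimono[OF that] gap_nonneg[of k] assms(1) by simp
  show "gap k = 0"
    using g0 assms by blast
  show "X k = X K"
    using assms(2)
  proof (induction rule: dec_induct)
    case (step n)
    have "c1 * (norm (X (Suc n) - X n))\<^sup>2 \<le> 0"
      using step_le_gap[of n] g0[of n] g0[of "Suc n"] step by simp
    then have "X (Suc n) = X n"
      using c_pos by (simp add: mult_le_0_iff)
    then show ?case
      using step by simp
  qed simp
qed

lemma limit_point: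
  assumes "strict_mono r" "(X \<circ> r) \<longlonglongrightarrow> y"
  shows "y \<in> zero_set S g" "h y = h_inf"
proof -
  have y: "y \<in> S"
    using closed_sequentially[OF closed_S _ assms(2)] X_in_S by simp
  have "(\<lambda>k. g ((X \<circ> r) k)) \<longlonglongrightarrow> g y" "(\<lambda>k. h ((X \<circ> r) k)) \<longlonglongrightarrow> h y"
    using X_in_S
    by (intro continuous_on_tendsto_compose[OF cont_g assms(2) y]
        continuous_on_tendsto_compose[OF cont_h assms(2) y]; simp)+
  moreover have "(\<lambda>k. g ((X \<circ> r) k)) \<longlonglongrightarrow> 0" "(\<lambda>k. h ((X \<circ> r) k)) \<longlonglongrightarrow> h_inf"
    using LIMSEQ_subseq_LIMSEQ[OF g_lim assms(1)] LIMSEQ_subseq_LIMSEQ[OF h_lim assms(1)]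
    by (simp_all add: comp_def)
  ultimately show "y \<in> zero_set S g" "h y = h_inf"
    using y by (auto simp: zero_set_def intro: LIMSEQ_unique)
qed

text \<open>Otherwise a subsequence stays outside \<open>U\<close>; by boundedness it has a
  convergent subsequence, whose limit lies in the open set \<open>U\<close> by
  \<open>limit_point\<close>.\<close>

lemma eventually_near_limit_points:
  assumes "open U"
    and U: "\<And>y. y \<in> zero_set S g \<Longrightarrow> h y = h_inf \<Longrightarrow> y \<in> U"
  shows "\<forall>\<^sub>F k in sequentially. X k \<in> U"
proof (rule ccontr)
  assume "\<not> ?thesis"
  then have "\<exists>\<^sub>F k in sequentially. X k \<notin> U"
    by (simp add: not_eventually)
  then have "infinite {k. X k \<notin> U}"
    by (simp add: cofinite_eq_sequentially[symmetric] frequently_cofinite)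
  then obtain r :: "nat \<Rightarrow> nat" where r: "strict_mono r" "\<And>n. X (r n) \<notin> U"
    using infinite_enumerate by blast
  have "bounded (range (X \<circ> r))"
    using bounded_X by (rule bounded_subset) auto
  then obtain l s where s: "strict_mono s" "(X \<circ> r \<circ> s) \<longlonglongrightarrow> l"
    using bounded_imp_convergent_subsequence by blast
  have rs: "strict_mono (r \<circ> s)"
    using r s by (simp add: strict_mono_o)
  have "l \<in> U"
    using U limit_point[OF rs] s by (simp add: comp_assoc)
  then have "\<forall>\<^sub>F k in sequentially. (X \<circ> r \<circ> s) k \<in> U"
    using s(2) \<open>open U\<close> topological_tendstoD by blast
  then show False
    using r(2) by simp
qed

lemma stepsize_sum_Suc: "stepsize_sum \<alpha> (Suc k) = stepsize_sum \<alpha> k + \<alpha> k"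
  by (simp add: stepsize_sum_def)

lemma stepsize_sum_nonneg: "0 \<le> stepsize_sum \<alpha> k"
  unfolding stepsize_sum_def by (intro sum_nonneg less_imp_le \<alpha>_pos)

text \<open>Reconciles two index conventions: the averages in \<open>ratio\<close> run from 1 to
  \<open>k\<close>, whereas \<open>stepsize_sum\<close> starts at 0 and omits its upper
  index.\<close>

lemma stepsize_sum_head: "(\<Sum>i=1..k. \<alpha> i) = stepsize_sum \<alpha> (Suc k) - \<alpha> 0"
  by (induction k) (simp_all add: stepsize_sum_def)

lemma eventually_ratio:
  "\<forall>\<^sub>F k in sequentially. 3 / 4 * c2 * (stepsize_sum \<alpha> (Suc k) - \<alpha> 0) \<le> (\<Sum>i=1..k. \<alpha> i * z i)"
proof -
  \<comment> \<open>Any factor strictly between 1/2 and 1 would serve: it stays below the liminf and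
    leaves a surplus over the rate constant \<open>c1 * c2 / 2\<close>.\<close>
  have "ereal (3 / 4 * c2) < ereal c2"
    using c_pos by simp
  then have "\<forall>\<^sub>F k in sequentially.
      ereal (3 / 4 * c2) < ereal ((\<Sum>i=1..k. \<alpha> i * z i) / (\<Sum>i=1..k. \<alpha> i))"
    using ratio by (intro less_LiminfD) (rule order_less_le_trans)
  then show ?thesis
    using eventually_gt_at_top[of 0]
  proof eventually_elim
    case (elim k)
    have "0 < (\<Sum>i=1..k. \<alpha> i)"
      using elim \<alpha>_pos by (intro sum_pos) auto
    then show ?case
      using elim(1) by (simp add: stepsize_sum_head[symmetric] field_simps)
  qed
qed

end

section \<open>Non-terminating trajectories governed by one modulus\<close>

locale descent_with_modulus = descent_trajectory + error_modulus +
  assumes gap_pos: "\<And>k. 0 < gap k"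
    and error_bound: "\<forall>\<^sub>F k in sequentially. \<phi> (gap k) \<le> g (X k)"
begin

text \<open>The decrease of the gap is at least \<open>c1 * (\<alpha> k * z k) * g (X k)\<close>,
  and \<open>g (X k)\<close> is at least \<open>\<phi> (gap k)\<close>. Division by the latter gives
  the lower bound for the increase of \<open>psi\<close> in \<open>psi_diff_ge\<close>.\<close>

lemma psi_step:
  assumes "gap k < \<eta>" "\<phi> (gap k) \<le> g (X k)"
  shows "psi (gap k) + c1 * (\<alpha> k * z k) \<le> psi (gap (Suc k))"
proof -
  have \<phi>: "0 < \<phi> (gap k)"
    using pos gap_pos assms by blast
  have "\<alpha> k * (c1 * (\<alpha> k * z k) * g (X k)) \<le> \<alpha> k * (gap k - gap (Suc k))"
    using step_le_gap[of k] step[of k] \<phi> assms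
    by (simp add: power2_eq_square algebra_simps)
  then have "c1 * (\<alpha> k * z k) * g (X k) \<le> gap k - gap (Suc k)"
    using \<alpha>_pos[of k] by simp
  moreover have "c1 * (\<alpha> k * z k) * \<phi> (gap k) \<le> c1 * (\<alpha> k * z k) * g (X k)"
    using assms c_pos \<alpha>_pos[of k] z_nonneg[of k] by (intro mult_left_mono) auto
  ultimately have "c1 * (\<alpha> k * z k) \<le> (gap k - gap (Suc k)) / \<phi> (gap k)"
    using \<phi> by (simp add: field_simps)
  also have "\<dots> \<le> psi (gap (Suc k)) - psi (gap k)"
    using assms gap_pos gap_antimono[of k "Suc k"] by (intro psi_diff_ge) auto
  finally show ?thesis
    by simp
qed

lemma eventually_gap_less: "\<forall>\<^sub>F k in sequentially. gap k < \<eta>"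
  using gap_lim t0 by (intro order_tendstoD(2)[of gap 0]) auto

text \<open>Summing \<open>psi_step\<close> gives growth at rate \<open>3 / 4 * c1 * c2\<close> up
  to constants. The surplus over \<open>c1 * c2 / 2\<close> diverges with the stepsize sum and pays
  for these constants and for the advanced index \<open>Suc k\<close>, which
  \<open>tail_length_le\<close> relies on.\<close>

lemma eventually_psi_ge:
  "\<forall>\<^sub>F k in sequentially. c1 * c2 / 2 * stepsize_sum \<alpha> (Suc k) \<le> psi (gap k)"
proof -
  let ?A = "stepsize_sum \<alpha>"
  define Z where "Z k = (\<Sum>i=1..k. \<alpha> i * z i)" for k
  have "\<forall>\<^sub>F k in sequentially. gap k < \<eta> \<and> \<phi> (gap k) \<le> g (X k)"
    using eventually_gap_less error_bound by (rule eventually_conj)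
  then obtain K where K: "\<And>k. K \<le> k \<Longrightarrow> gap k < \<eta> \<and> \<phi> (gap k) \<le> g (X k)"
    by (auto simp: eventually_sequentially)
  define C where "C = psi (gap (Suc K)) - c1 * Z K"
  have *: "C + c1 * Z k \<le> psi (gap (Suc k))" if "K \<le> k" for k
    using that
  proof (induction rule: dec_induct)
    case (step n)
    then show ?case
      using psi_step[of "Suc n"] K[of "Suc n"] by (simp add: Z_def algebra_simps)
  qed (simp add: C_def)
  \<comment> \<open>This threshold is the inequality \<open>B\<close> below, multiplied by 4 and
    solved for \<open>?A (Suc k)\<close>.\<close>
  let ?B = "(3 * (c1 * c2 * \<alpha> 0) + 2 * (c1 * c2 * b) - 4 * C) / (c1 * c2)"
  have "\<forall>\<^sub>F k in sequentially. ?B \<le> ?A (Suc k)"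
    using \<alpha>_sum unfolding eventually_sequentially_Suc[of "\<lambda>k. ?B \<le> ?A k"] filterlim_at_top
    by blast
  then have "\<forall>\<^sub>F k in sequentially. c1 * c2 / 2 * ?A (Suc (Suc k)) \<le> psi (gap (Suc k))"
    using eventually_ratio eventually_ge_at_top[of K]
  proof eventually_elim
    case (elim k)
    have c: "0 < c1 * c2"
      using c_pos by simp
    have "3 * (c1 * c2 * \<alpha> 0) + 2 * (c1 * c2 * b) - 4 * C \<le> c1 * c2 * ?A (Suc k)"
      using elim(1) unfolding pos_divide_le_eq[OF c] by (simp only: mult.commute)
    moreover have "4 * (c1 * c2 / 2 * (?A (Suc k) + b)) = 2 * (c1 * c2 * ?A (Suc k)) + 2 * (c1 * c2 * b)"
      by (simp add: algebra_simps)
    moreover have "4 * (c1 * (3 / 4 * c2 * (?A (Suc k) - \<alpha> 0)))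
        = 3 * (c1 * c2 * (?A (Suc k) - \<alpha> 0))"
      by simp
    moreover have "\<dots> = 3 * (c1 * c2 * ?A (Suc k)) - 3 * (c1 * c2 * \<alpha> 0)"
      by (simp add: right_diff_distrib)
    ultimately have B: "c1 * c2 / 2 * (?A (Suc k) + b) \<le> C + c1 * (3 / 4 * c2 * (?A (Suc k) - \<alpha> 0))"
      by linarith
    \<comment> \<open>The stepsize bound \<open>b\<close> makes the shift by one index cost only a
      constant.\<close>
    have "c1 * c2 / 2 * ?A (Suc (Suc k)) \<le> c1 * c2 / 2 * (?A (Suc k) + b)"
      using c_pos \<alpha>_le[of "Suc k"]
      by (intro mult_left_mono) (auto simp: stepsize_sum_Suc[of "Suc k"])
    also note B
    also have "C + c1 * (3 / 4 * c2 * (?A (Suc k) - \<alpha> 0)) \<le> C + c1 * Z k"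
      using elim(2) c_pos unfolding Z_def by (intro add_left_mono mult_left_mono) auto
    also have "\<dots> \<le> psi (gap (Suc k))"
      using * elim(3) by blast
    finally show ?case .
  qed
  then show ?thesis
    by (subst (asm) eventually_sequentially_Suc)
qed

text \<open>As \<open>psi\<close> decreases, \<open>psi_ge\<close> says
  \<open>gap i \<le> r (Suc i)\<close>, which is the ordering required by
  \<open>step_length_le\<close>; the resulting bounds telescope. The sequence \<open>r\<close> is
  arbitrary, so that it can come from \<open>psi_attains\<close> when convergence is proved and from
  \<open>Psi_inv\<close> for the rates.\<close>

lemma tail_length_le:
  assumes psi_ge: "\<And>k. K \<le> k \<Longrightarrow> c1 * c2 / 2 * stepsize_sum \<alpha> (Suc k) \<le> psi (gap k)"
    and less: "\<And>k. K \<le> k \<Longrightarrow> gap k < \<eta>"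
    and r: "\<And>k. K \<le> k \<Longrightarrow> 0 < r k \<and> r k < \<eta> \<and> psi (r k) = c1 * c2 / 2 * stepsize_sum \<alpha> k"
    and k: "K \<le> k" "k \<le> n"
  shows "gap k \<le> r k"
    and "(\<Sum>i=k..<n. norm (X (Suc i) - X i)) \<le> sqrt 2 / (c1 * sqrt c2) * Phi \<phi> (r k)"
proof -
  let ?c = "c1 * c2 / 2"
  let ?q = "sqrt (?c * c1)"
  have c: "0 < ?c" "0 < ?q"
    using c_pos by auto
  have gap_r: "gap i \<le> r (Suc i)" if "K \<le> i" for i
    using psi_le_imp_ge[of "r (Suc i)" "gap i"] r[of "Suc i"] psi_ge[OF that] less[OF that]
      gap_pos[of i] that by simp
  have r_anti: "r (Suc i) \<le> r i" if "K \<le> i" for i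
  proof -
    have "?c * stepsize_sum \<alpha> i \<le> ?c * stepsize_sum \<alpha> (Suc i)"
      using c(1) \<alpha>_pos[of i] by (intro mult_left_mono) (auto simp: stepsize_sum_Suc)
    then show ?thesis
      using psi_le_imp_ge[of "r i" "r (Suc i)"] r[OF that] r[OF le_SucI[OF that]] by simp
  qed
  show gap_le: "gap k \<le> r k"
    using gap_r[OF k(1)] r_anti[OF k(1)] by linarith
  let ?T = "\<lambda>n. Phi \<phi> (gap n) + Phi \<phi> (r n)"
  have "(\<Sum>i=k..<n. norm (X (Suc i) - X i)) * ?q \<le> (?T k - ?T n) / 2"
    using k(2)
  proof (induction rule: dec_induct)
    case (step n)
    then have n: "K \<le> n"
      using k by simp
    have "norm (X (Suc n) - X n) * ?q
        \<le> ((Phi \<phi> (gap n) - Phi \<phi> (gap (Suc n))) + (Phi \<phi> (r n) - Phi \<phi> (r (Suc n)))) / 2"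
    proof (rule step_length_le[where a = "\<alpha> n"])
      show "psi (r (Suc n)) - psi (r n) = ?c * \<alpha> n"
        using r[OF n] r[of "Suc n"] n by (simp add: stepsize_sum_Suc algebra_simps)
    qed (use n c c_pos \<alpha>_pos gap_pos gap_r r_anti r[OF n] step_le_gap gap_antimono[of n "Suc n"] in auto)
    then show ?case
      using step by (simp add: algebra_simps)
  qed simp
  \<comment> \<open>The terms at \<open>n\<close> are nonnegative and drop out; the half sum at
    \<open>k\<close> is at most its larger term, since \<open>gap k \<le> r k\<close>.\<close>
  also have "\<dots> \<le> Phi \<phi> (r k)"
  proof -
    have "Phi \<phi> (gap k) \<le> Phi \<phi> (r k)"
    proof -
      have "0 \<le> (r k - gap k) / sqrt (\<phi> (r k))"
        using gap_le nonneg r[OF k(1)] by simp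
      also have "\<dots> \<le> Phi \<phi> (r k) - Phi \<phi> (gap k)"
        using gap_le gap_pos r[OF k(1)] by (intro Phi_diff_ge) auto
      finally show ?thesis
        by simp
    qed
    moreover have "0 \<le> Phi \<phi> (gap n)" "0 \<le> Phi \<phi> (r n)"
      using k less[of n] r[of n] by (auto intro!: Phi_nonneg)
    ultimately show ?thesis
      by simp
  qed
  finally have "(\<Sum>i=k..<n. norm (X (Suc i) - X i)) \<le> 1 / ?q * Phi \<phi> (r k)"
    using c(2) by (simp add: field_simps)
  moreover have "1 / ?q = sqrt 2 / (c1 * sqrt c2)"
  proof -
    have "?q = sqrt (c1\<^sup>2 * c2 / 2)"
      by (simp add: power2_eq_square)
    also have "\<dots> = c1 * sqrt c2 / sqrt 2"
      using c_pos by (simp add: real_sqrt_mult real_sqrt_divide)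
    finally show ?thesis
      by simp
  qed
  ultimately show "(\<Sum>i=k..<n. norm (X (Suc i) - X i)) \<le> sqrt 2 / (c1 * sqrt c2) * Phi \<phi> (r k)"
    by (simp only:)
qed

text \<open>The increments are absolutely summable: \<open>tail_length_le\<close> bounds every
  partial sum from \<open>K\<close> on by the same number.\<close>

lemma convergent_X: "convergent X"
proof -
  have "\<forall>\<^sub>F k in sequentially. gap k < \<eta> \<and> c1 * c2 / 2 * stepsize_sum \<alpha> (Suc k) \<le> psi (gap k)"
    using eventually_gap_less eventually_psi_ge by (rule eventually_conj)
  then obtain K where K: "\<And>k. K \<le> k \<Longrightarrow>
      gap k < \<eta> \<and> c1 * c2 / 2 * stepsize_sum \<alpha> (Suc k) \<le> psi (gap k)"
    by (auto simp: eventually_sequentially)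
  \<comment> \<open>The level lies between 0 and \<open>psi (gap k)\<close>, hence is
    attained.\<close>
  have "\<exists>r. 0 < r \<and> r < \<eta> \<and> psi r = c1 * c2 / 2 * stepsize_sum \<alpha> k" if "K \<le> k" for k
  proof -
    have "c1 * c2 / 2 * stepsize_sum \<alpha> k \<le> c1 * c2 / 2 * stepsize_sum \<alpha> (Suc k)"
      using c_pos \<alpha>_pos[of k] by (intro mult_left_mono) (auto simp: stepsize_sum_Suc)
    then have "c1 * c2 / 2 * stepsize_sum \<alpha> k \<le> psi (gap k)"
      using K[OF that] by linarith
    then show ?thesis
      using psi_attains[of "gap k"] gap_pos[of k] K[OF that] c_pos stepsize_sum_nonneg[of k]
      by (metis divide_nonneg_pos mult_nonneg_nonneg less_imp_le zero_less_numeral)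
  qed
  then obtain r where r: "\<And>k. K \<le> k \<Longrightarrow>
      0 < r k \<and> r k < \<eta> \<and> psi (r k) = c1 * c2 / 2 * stepsize_sum \<alpha> k"
    by metis
  let ?L = "sqrt 2 / (c1 * sqrt c2) * Phi \<phi> (r K)"
  have "summable (\<lambda>i. norm (X (Suc (i + K)) - X (i + K)))"
  proof (rule summableI_nonneg_bounded)
    show "(\<Sum>i<n. norm (X (Suc (i + K)) - X (i + K))) \<le> ?L" for n
    proof -
      have "(\<Sum>i<n. norm (X (Suc (i + K)) - X (i + K)))
          = (\<Sum>i=K..<K + n. norm (X (Suc i) - X i))"
        using sum.shift_bounds_nat_ivl[of "\<lambda>i. norm (X (Suc i) - X i)" 0 K n]
        by (simp add: lessThan_atLeast0 add.commute)
      also have "\<dots> \<le> ?L"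
        using K r by (intro tail_length_le) auto
      finally show ?thesis .
    qed
  qed simp
  then have "summable (\<lambda>i. X (Suc (i + K)) - X (i + K))"
    by (rule summable_norm_cancel)
  then have "convergent (\<lambda>n. \<Sum>i<n. X (Suc (i + K)) - X (i + K))"
    by (simp add: summable_iff_convergent)
  moreover have "(\<Sum>i<n. X (Suc (i + K)) - X (i + K)) = X (n + K) - X K" for n
    using sum_lessThan_telescope[of "\<lambda>i. X (i + K)" n] by simp
  ultimately have "convergent (\<lambda>n. X (n + K) - X K)"
    by simp
  then have "convergent (\<lambda>n. X (n + K))"
    by (simp add: convergent_diff_const_right_iff)
  then show ?thesis
    using convergent_ignore_initial_segment by blast
qed

text \<open>Integrability would bound \<open>psi\<close>, whereas \<open>psi (gap k)\<close>
  dominates a multiple of the divergent stepsize sum. By contraposition, integrability forces some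
  gap to vanish and hence finite termination.\<close>

lemma not_integrable: "\<not> integrable_near_0 \<eta> (\<lambda>s. 1 / \<phi> s)"
proof
  assume "integrable_near_0 \<eta> (\<lambda>s. 1 / \<phi> s)"
  then obtain B where B: "\<And>t. 0 < t \<Longrightarrow> t < \<eta> \<Longrightarrow> psi t \<le> B"
    using psi_bounded by blast
  have c: "0 < c1 * c2 / 2"
    using c_pos by simp
  have "\<forall>\<^sub>F k in sequentially. (B + 1) / (c1 * c2 / 2) \<le> stepsize_sum \<alpha> (Suc k)"
    using \<alpha>_sum
    unfolding eventually_sequentially_Suc[of "\<lambda>k. (B + 1) / (c1 * c2 / 2) \<le> stepsize_sum \<alpha> k"]
      filterlim_at_top
    by blast
  then have "\<forall>\<^sub>F k in sequentially. False"
    using eventually_psi_ge eventually_gap_less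
  proof eventually_elim
    case (elim k)
    then show ?case
      using B[of "gap k"] gap_pos[of k] unfolding pos_divide_le_eq[OF c]
      by (simp add: mult.commute)
  qed
  then show False
    by simp
qed

text \<open>The distance from \<open>X k\<close> to \<open>X n\<close> is at most the path length
  between them, which is bounded uniformly in \<open>n\<close>; then \<open>n\<close> tends to
  infinity.\<close>

lemma rates:
  assumes "X \<longlonglongrightarrow> y"
  defines "\<rho> \<equiv> \<lambda>k. Psi_inv \<eta> \<phi> t0 (ereal (c1 * c2 / 2 * stepsize_sum \<alpha> k))"
  shows "\<forall>\<^sub>F k in sequentially. gap k \<le> \<rho> k \<and>
    norm (X k - y) \<le> sqrt 2 / (c1 * sqrt c2) * Phi \<phi> (\<rho> k)"
proof -
  have "\<forall>\<^sub>F k in sequentially. gap k < \<eta> \<and> c1 * c2 / 2 * stepsize_sum \<alpha> (Suc k) \<le> psi (gap k)"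
    using eventually_gap_less eventually_psi_ge by (rule eventually_conj)
  then obtain K where K: "\<And>k. K \<le> k \<Longrightarrow>
      gap k < \<eta> \<and> c1 * c2 / 2 * stepsize_sum \<alpha> (Suc k) \<le> psi (gap k)"
    by (auto simp: eventually_sequentially)
  have \<rho>: "0 < \<rho> k \<and> \<rho> k < \<eta> \<and> psi (\<rho> k) = c1 * c2 / 2 * stepsize_sum \<alpha> k" for k
  proof -
    have "0 \<le> c1 * c2 / 2 * stepsize_sum \<alpha> k"
      using c_pos stepsize_sum_nonneg[of k] by simp
    then show ?thesis
      unfolding \<rho>_def using Psi_inv_eq[OF not_integrable] by blast
  qed
  show ?thesis
    using eventually_ge_at_top[of K]
  proof eventually_elim
    case (elim k)
    have "norm (X k - y) \<le> sqrt 2 / (c1 * sqrt c2) * Phi \<phi> (\<rho> k)"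
    proof (rule LIMSEQ_le_const2)
      show "(\<lambda>n. norm (X k - X n)) \<longlonglongrightarrow> norm (X k - y)"
        using assms(1) by (intro tendsto_intros)
      have "norm (X k - X n) \<le> sqrt 2 / (c1 * sqrt c2) * Phi \<phi> (\<rho> k)" if "k \<le> n" for n
      proof -
        have "norm (X k - X n) = norm (\<Sum>i=k..<n. X (Suc i) - X i)"
          using that by (simp add: sum_Suc_diff' norm_minus_commute)
        also have "\<dots> \<le> (\<Sum>i=k..<n. norm (X (Suc i) - X i))"
          by (rule norm_sum)
        also have "\<dots> \<le> sqrt 2 / (c1 * sqrt c2) * Phi \<phi> (\<rho> k)"
          using K \<rho> elim that by (intro tail_length_le[of K]) auto
        finally show ?thesis .
      qed
      then show "\<exists>N. \<forall>n\<ge>N. norm (X k - X n) \<le> sqrt 2 / (c1 * sqrt c2) * Phi \<phi> (\<rho> k)"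
        by blast
    qed
    moreover have "gap k \<le> \<rho> k"
      using tail_length_le(1)[of K \<rho> k k] K \<rho> elim by blast
    ultimately show ?case
      by blast
  qed
qed

end

section \<open>Combining moduli by compactness\<close>

text \<open>The reciprocal square root of a minimum is the maximum of the two reciprocal square
  roots, hence integrable near 0.\<close>

lemma error_modulus_min:
  assumes "error_modulus \<eta>1 \<phi>1 t1" "error_modulus \<eta>2 \<phi>2 t2"
  shows "error_modulus (min \<eta>1 \<eta>2) (\<lambda>s. min (\<phi>1 s) (\<phi>2 s)) (min t1 t2)"
proof -
  interpret e1: error_modulus \<eta>1 \<phi>1 t1 by fact
  interpret e2: error_modulus \<eta>2 \<phi>2 t2 by fact
  let ?t = "min t1 t2"
  have t: "0 < ?t" "?t < \<eta>1" "?t < \<eta>2"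
    using e1.t0 e2.t0 by auto
  have "integrable lborel (\<lambda>s. max (indicator {0..?t} s *\<^sub>R (1 / sqrt (\<phi>1 s)))
      (indicator {0..?t} s *\<^sub>R (1 / sqrt (\<phi>2 s))))"
    using e1.integrable_inverse_sqrt[OF t(2)] e2.integrable_inverse_sqrt[OF t(3)]
    unfolding set_integrable_def by (rule integrable_max)
  moreover have "max (indicator {0..?t} s *\<^sub>R (1 / sqrt (\<phi>1 s)))
      (indicator {0..?t} s *\<^sub>R (1 / sqrt (\<phi>2 s)))
    = indicator {0..?t} s *\<^sub>R (1 / sqrt (min (\<phi>1 s) (\<phi>2 s)))" for s
  proof (cases "0 < s \<and> s \<le> ?t")
    case True
    then have "0 < \<phi>1 s" "0 < \<phi>2 s"
      using e1.pos e2.pos t by auto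
    then show ?thesis
      using True by (cases "\<phi>1 s \<le> \<phi>2 s") (auto simp: max_def min_def field_simps)
  next
    case False
    then show ?thesis
      using e1.zero e2.zero by (cases "s = 0") (auto simp: indicator_def)
  qed
  ultimately have "set_integrable lborel {0..?t} (\<lambda>s. 1 / sqrt (min (\<phi>1 s) (\<phi>2 s)))"
    by (simp add: set_integrable_def)
  then have "integrable_near_0 (min \<eta>1 \<eta>2) (\<lambda>s. 1 / sqrt (min (\<phi>1 s) (\<phi>2 s)))"
    using t unfolding integrable_near_0_def by (intro bexI[of _ ?t]) auto
  moreover have "mono_on {0<..<min \<eta>1 \<eta>2} (\<lambda>s. min (\<phi>1 s) (\<phi>2 s))"
    using e1.le e2.le by (auto simp: mono_on_def min_le_iff_disj)
  ultimately show ?thesis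
    using t e1.zero e2.zero e1.pos e2.pos by unfold_locales auto
qed

text \<open>The minimum is below each modulus, so a point needs to lie in only one of the balls. A
  common level \<open>l\<close> replaces the values of \<open>h\<close> at the centres, which agree
  in the application.\<close>

lemma finite_cover_error_modulus:
  fixes g h :: "'a::metric_space \<Rightarrow> real"
  assumes "finite D" "D \<noteq> {}"
    and "\<And>y. y \<in> D \<Longrightarrow> error_modulus (\<eta> y) (\<phi> y) (t0 y)"
    and "\<And>y u. y \<in> D \<Longrightarrow> u \<in> S \<Longrightarrow> u \<in> ball y (\<delta> y) \<Longrightarrow> l < h u \<Longrightarrow> h u < l + \<eta> y \<Longrightarrow>
      \<phi> y (h u - l) \<le> g u"
  shows "\<exists>\<eta>' \<phi>' t'. error_modulus \<eta>' \<phi>' t' \<and>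
    (\<forall>u\<in>S. u \<in> (\<Union>y\<in>D. ball y (\<delta> y)) \<longrightarrow> l < h u \<longrightarrow> h u < l + \<eta>' \<longrightarrow> \<phi>' (h u - l) \<le> g u)"
  using assms
proof (induction rule: finite_ne_induct)
  case (singleton y)
  then show ?case
    by (intro exI[of _ "\<eta> y"] exI[of _ "\<phi> y"] exI[of _ "t0 y"]) auto
next
  case (insert y D)
  have "\<exists>\<eta>' \<phi>' t'. error_modulus \<eta>' \<phi>' t' \<and>
    (\<forall>u\<in>S. u \<in> (\<Union>y\<in>D. ball y (\<delta> y)) \<longrightarrow> l < h u \<longrightarrow> h u < l + \<eta>' \<longrightarrow> \<phi>' (h u - l) \<le> g u)"
    by (rule insert.IH; rule insert.prems; simp)
  then obtain \<eta>' \<phi>' t' where e: "error_modulus \<eta>' \<phi>' t'"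
    and b: "\<And>u. u \<in> S \<Longrightarrow> u \<in> (\<Union>y\<in>D. ball y (\<delta> y)) \<Longrightarrow> l < h u \<Longrightarrow> h u < l + \<eta>' \<Longrightarrow>
      \<phi>' (h u - l) \<le> g u"
    by blast
  have "error_modulus (min (\<eta> y) \<eta>') (\<lambda>s. min (\<phi> y s) (\<phi>' s)) (min (t0 y) t')"
    using insert.prems(1) e by (intro error_modulus_min) auto
  moreover have "min (\<phi> y (h u - l)) (\<phi>' (h u - l)) \<le> g u"
    if "u \<in> S" "u \<in> (\<Union>y\<in>insert y D. ball y (\<delta> y))" "l < h u" "h u < l + min (\<eta> y) \<eta>'" for u
  proof -
    have less: "h u < l + \<eta> y" "h u < l + \<eta>'"
      using that(4) by auto
    show ?thesis
      using that(2) insert.prems(2)[OF _ that(1) _ that(3) less(1)] b[OF that(1) _ that(3) less(2)]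
      unfolding min_le_iff_disj by blast
  qed
  ultimately show ?case
    by (intro exI[of _ "min (\<eta> y) \<eta>'"] exI[of _ "\<lambda>s. min (\<phi> y s) (\<phi>' s)"] exI[of _ "min (t0 y) t'"])
      blast
qed

lemma (in descent_trajectory) descent_with_modulusI:
  assumes "error_modulus \<eta> \<phi> t0" "\<And>k. 0 < gap k"
    and "\<forall>\<^sub>F k in sequentially. X k \<in> U"
    and "\<And>u. u \<in> S \<Longrightarrow> u \<in> U \<Longrightarrow> h_inf < h u \<Longrightarrow> h u < h_inf + \<eta> \<Longrightarrow> \<phi> (h u - h_inf) \<le> g u"
  shows "descent_with_modulus X S g h c1 c2 \<alpha> z b \<eta> \<phi> t0"
proof -
  interpret error_modulus \<eta> \<phi> t0 by fact
  have "\<forall>\<^sub>F k in sequentially. gap k < \<eta>"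
    using gap_lim t0 by (intro order_tendstoD(2)[of gap 0]) auto
  then have "\<forall>\<^sub>F k in sequentially. \<phi> (gap k) \<le> g (X k)"
    using assms(3)
  proof eventually_elim
    case (elim k)
    then show ?case
      using assms(4)[of "X k"] assms(2)[of k] X_in_S[of k] by (simp add: gap_def)
  qed
  then show ?thesis
    using assms(2) by unfold_locales
qed

text \<open>If some gap vanishes, the trajectory is eventually constant. Otherwise a combined
  modulus yields the limit \<open>y\<close>, and only then can \<open>\<phi> y\<close> be used for
  the rates.\<close>

lemma (in descent_trajectory) convergence_and_rates:
  assumes leb: "local_error_bound S g h \<eta> \<phi>"
    and t0: "\<forall>y\<in>zero_set S g. t0 y \<in> {0<..<\<eta> y}"
    and int: "\<forall>y\<in>zero_set S g. integrable_near_0 (\<eta> y) (\<lambda>s. 1 / sqrt (\<phi> y s))"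
  obtains y where "y \<in> zero_set S g" "X \<longlonglongrightarrow> y"
    and "integrable_near_0 (\<eta> y) (\<lambda>s. 1 / \<phi> y s) \<Longrightarrow> \<exists>K. \<forall>k\<ge>K. X k = X K"
    and "\<not> integrable_near_0 (\<eta> y) (\<lambda>s. 1 / \<phi> y s) \<Longrightarrow>
      \<forall>\<^sub>F k in sequentially.
        gap k \<le> Psi_inv (\<eta> y) (\<phi> y) (t0 y) (ereal (c1 * c2 / 2 * stepsize_sum \<alpha> k)) \<and>
        norm (X k - y) \<le> sqrt 2 / (c1 * sqrt c2) *
          Phi (\<phi> y) (Psi_inv (\<eta> y) (\<phi> y) (t0 y) (ereal (c1 * c2 / 2 * stepsize_sum \<alpha> k)))"
proof -
  have em: "error_modulus (\<eta> y) (\<phi> y) (t0 y)" if "y \<in> zero_set S g" for y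
    using that leb t0 int by unfold_locales (auto simp: local_error_bound_def)
  have "\<forall>y\<in>zero_set S g. \<exists>\<delta>>0. \<forall>u\<in>S. norm (u - y) < \<delta> \<and> h y < h u \<and> h u < h y + \<eta> y \<longrightarrow>
      \<phi> y (h u - h y) \<le> g u"
    using leb by (simp add: local_error_bound_def)
  then obtain \<delta> where \<delta>: "\<And>y. y \<in> zero_set S g \<Longrightarrow> 0 < \<delta> y"
    and bound: "\<And>y u. y \<in> zero_set S g \<Longrightarrow> u \<in> S \<Longrightarrow> u \<in> ball y (\<delta> y) \<Longrightarrow> h y < h u \<Longrightarrow>
      h u < h y + \<eta> y \<Longrightarrow> \<phi> y (h u - h y) \<le> g u"
    by (simp add: dist_norm norm_minus_commute) metis
  have limit: "y \<in> zero_set S g \<and> h y = h_inf" if "X \<longlonglongrightarrow> y" for y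
    using limit_point[of id y] that by (simp add: strict_mono_def)
  show ?thesis
  proof (cases "\<exists>K. gap K = 0")
    case True
    then obtain K where K: "gap K = 0" ..
    note st = stationary[OF K]
    have lim: "X \<longlonglongrightarrow> X K"
      using st(2) by (intro tendsto_eventually eventually_sequentiallyI)
    show ?thesis
    proof (rule that[of "X K"])
      let ?y = "X K"
      show y: "?y \<in> zero_set S g"
        using limit[OF lim] by simp
      \<comment> \<open>Termination is also compatible with a non-integrable
        \<open>1 / \<phi>\<close>; the rates then hold because both left-hand sides are 0.\<close>
      assume n: "\<not> integrable_near_0 (\<eta> ?y) (\<lambda>s. 1 / \<phi> ?y s)"
      interpret error_modulus "\<eta> ?y" "\<phi> ?y" "t0 ?y"
        using em[OF y] .
      let ?r = "\<lambda>k. Psi_inv (\<eta> ?y) (\<phi> ?y) (t0 ?y) (ereal (c1 * c2 / 2 * stepsize_sum \<alpha> k))"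
      show "\<forall>\<^sub>F k in sequentially. gap k \<le> ?r k \<and>
          norm (X k - ?y) \<le> sqrt 2 / (c1 * sqrt c2) * Phi (\<phi> ?y) (?r k)"
        using eventually_ge_at_top[of K]
      proof eventually_elim
        case (elim k)
        have "0 < ?r k" "?r k < \<eta> ?y"
          using c_pos stepsize_sum_nonneg[of k] by (intro Psi_inv_eq n; simp)+
        then show ?case
          using st[OF elim] c_pos Phi_nonneg by simp
      qed
    qed (use lim st in blast)+
  next
    case False
    then have gap_pos: "0 < gap k" for k
      using gap_nonneg[of k] by (metis order_le_less)
    \<comment> \<open>Intersecting with the closure of the bounded range makes the set of candidate
      limits compact.\<close>
    let ?\<Omega> = "closure (range X) \<inter> ({y \<in> S. g y = 0} \<inter> {y \<in> S. h y = h_inf})"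
    have "closed {y \<in> S. g y = 0}" "closed {y \<in> S. h y = h_inf}"
      using closed_S cont_g cont_h by (auto intro: continuous_closed_preimage_constant)
    then have "compact ?\<Omega>"
      using bounded_X by (intro compact_Int_closed) (auto simp: compact_closure)
    moreover have "?\<Omega> \<subseteq> (\<Union>y\<in>?\<Omega>. ball y (\<delta> y))"
      using \<delta> by (fastforce simp: zero_set_def)
    ultimately obtain D where D: "D \<subseteq> ?\<Omega>" "finite D" "?\<Omega> \<subseteq> (\<Union>y\<in>D. ball y (\<delta> y))"
      by (rule compactE_image[where f = "\<lambda>y. ball y (\<delta> y)", OF _ open_ball])
    let ?U = "\<Union>y\<in>D. ball y (\<delta> y)"
    have near: "\<forall>\<^sub>F k in sequentially. X k \<in> ?U"
    proof -
      \<comment> \<open>The added complement covers zeros of \<open>g\<close> at level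
        \<open>h_inf\<close> outside \<open>?\<Omega>\<close>; no iterate lies in it.\<close>
      have "\<forall>\<^sub>F k in sequentially. X k \<in> ?U \<union> - closure (range X)"
        using D(3) by (intro eventually_near_limit_points) (auto simp: zero_set_def)
      then show ?thesis
        by eventually_elim (use closure_subset[of "range X"] in auto)
    qed
    then have "D \<noteq> {}"
      by auto
    have D': "y \<in> zero_set S g" "h y = h_inf" if "y \<in> D" for y
      using that D(1) by (auto simp: zero_set_def)
    have "\<exists>\<eta>' \<phi>' t'. error_modulus \<eta>' \<phi>' t' \<and> (\<forall>u\<in>S. u \<in> ?U \<longrightarrow> h_inf < h u \<longrightarrow>
        h u < h_inf + \<eta>' \<longrightarrow> \<phi>' (h u - h_inf) \<le> g u)"
    proof (rule finite_cover_error_modulus[OF D(2) \<open>D \<noteq> {}\<close>])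
      show "error_modulus (\<eta> y) (\<phi> y) (t0 y)" if "y \<in> D" for y
        using em D'(1) that by blast
      show "\<phi> y (h u - h_inf) \<le> g u"
        if "y \<in> D" "u \<in> S" "u \<in> ball y (\<delta> y)" "h_inf < h u" "h u < h_inf + \<eta> y" for y u
        using bound[OF D'(1)] D'(2) that by simp
    qed
    then obtain \<eta>' \<phi>' t' where "error_modulus \<eta>' \<phi>' t'"
      and "\<And>u. u \<in> S \<Longrightarrow> u \<in> ?U \<Longrightarrow> h_inf < h u \<Longrightarrow> h u < h_inf + \<eta>' \<Longrightarrow> \<phi>' (h u - h_inf) \<le> g u"
      by blast
    then have "descent_with_modulus X S g h c1 c2 \<alpha> z b \<eta>' \<phi>' t'"
      using gap_pos near by (intro descent_with_modulusI)
    then have "convergent X"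
      by (rule descent_with_modulus.convergent_X)
    then obtain y where y: "X \<longlonglongrightarrow> y"
      by (auto simp: convergent_def)
    then have zy: "y \<in> zero_set S g" "h y = h_inf"
      using limit by blast+
    have "\<forall>\<^sub>F k in sequentially. X k \<in> ball y (\<delta> y)"
      using topological_tendstoD[OF y, of "ball y (\<delta> y)"] \<delta>[OF zy(1)] by simp
    then interpret descent_with_modulus X S g h c1 c2 \<alpha> z b "\<eta> y" "\<phi> y" "t0 y"
      using em[OF zy(1)] gap_pos bound[OF zy(1)] zy(2)
      by (intro descent_with_modulusI[where U = "ball y (\<delta> y)"]) auto
    show ?thesis
      \<comment> \<open>All gaps are positive here, so \<open>not_integrable\<close> makes the
        termination claim vacuous.\<close>
      by (rule that[OF zy(1) y]) (use not_integrable rates[OF y] in auto)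
  qed
qed

section \<open>Return to the randomized algorithm\<close>

lemma (in monotone_randomized_algorithm) descent_trajectory:
  assumes "stepsize_condition \<alpha>"
    and \<omega>: "\<omega> \<in> event_E0 M x g c2 \<alpha>" "\<omega> \<in> event_E1 M x"
  shows "\<exists>b. descent_trajectory (\<lambda>k. x k \<omega>) S g h c1 c2 \<alpha> (\<lambda>k. step_ratio x g c2 \<alpha> k \<omega>) b"
proof -
  obtain b where b: "\<And>k. \<alpha> k \<le> b" "filterlim (stepsize_sum \<alpha>) at_top sequentially"
    using assms(1) by (auto simp: stepsize_condition_def)
  have "\<omega> \<in> space M"
    using \<omega> by (simp add: event_E0_def)
  then have "descent_trajectory (\<lambda>k. x k \<omega>) S g h c1 c2 \<alpha> (\<lambda>k. step_ratio x g c2 \<alpha> k \<omega>) b"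
    using b \<omega> c_pos \<alpha>_pos x_in_S descent
    by unfold_locales
      (auto simp: closed_S cont_g cont_h h_bdd_below event_E0_def event_E1_def step_ratio_def
        less_imp_neq[symmetric] less_imp_neq[OF \<alpha>_pos, symmetric])
  then show ?thesis ..
qed

theorem theorem7:
  fixes M :: "'w measure" and \<F> :: "nat \<Rightarrow> 'w measure"
    and x :: "nat \<Rightarrow> 'w \<Rightarrow> real ^ 'd"
    and S :: "(real ^ 'd) set"
    and g h :: "real ^ 'd \<Rightarrow> real"
    and c1 c2 c3 :: real
    and \<alpha> :: "nat \<Rightarrow> real"
    and \<eta> t0 :: "real ^ 'd \<Rightarrow> real"
    and \<phi> :: "real ^ 'd \<Rightarrow> real \<Rightarrow> real"
  assumes "monotone_randomized_algorithm M \<F> x S g h c1 c2 c3 \<alpha>"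
    and "stepsize_condition \<alpha>"
    and "local_error_bound S g h \<eta> \<phi>"
    and "\<forall>y\<in>zero_set S g. t0 y \<in> {0<..<\<eta> y}"
    and "\<forall>y\<in>zero_set S g. integrable_near_0 (\<eta> y) (\<lambda>s. 1 / sqrt (\<phi> y s))"
  shows "\<exists>xs \<in> borel_measurable M.
    \<forall>\<omega> \<in> event_E0 M x g c2 \<alpha> \<inter> event_E1 M x.
      xs \<omega> \<in> zero_set S g \<and> (\<lambda>k. x k \<omega>) \<longlonglongrightarrow> xs \<omega> \<and>
      (integrable_near_0 (\<eta> (xs \<omega>)) (\<lambda>s. 1 / \<phi> (xs \<omega>) s) \<longrightarrow>
        (\<exists>K. \<forall>k\<ge>K. x k \<omega> = x K \<omega>)) \<and>
      (\<not> integrable_near_0 (\<eta> (xs \<omega>)) (\<lambda>s. 1 / \<phi> (xs \<omega>) s) \<longrightarrow>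
        (\<exists>K>0. \<forall>k\<ge>K.
          (let \<rho> = Psi_inv (\<eta> (xs \<omega>)) (\<phi> (xs \<omega>)) (t0 (xs \<omega>))
                     (ereal (c1 * c2 / 2 * stepsize_sum \<alpha> k))
           in h (x k \<omega>) - h_limit x h \<omega> \<le> \<rho> \<and>
              norm (x k \<omega> - xs \<omega>) \<le> sqrt 2 / (c1 * sqrt c2) * Phi (\<phi> (xs \<omega>)) \<rho>)))"
proof (intro bexI ballI)
  interpret monotone_randomized_algorithm M \<F> x S g h c1 c2 c3 \<alpha> by fact
  \<comment> \<open>As \<open>lim\<close> is total, this is a single random variable on all of
    \<open>space M\<close>; its value is arbitrary where the iterates diverge.\<close>
  let ?xs = "\<lambda>\<omega>. lim (\<lambda>k. x k \<omega>)"
  show "?xs \<in> borel_measurable M"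
    using measurable_from_subalg[OF subalg adapted] by (rule borel_measurable_lim_metric)
  fix \<omega>
  assume \<omega>: "\<omega> \<in> event_E0 M x g c2 \<alpha> \<inter> event_E1 M x"
  then obtain b where
    "descent_trajectory (\<lambda>k. x k \<omega>) S g h c1 c2 \<alpha> (\<lambda>k. step_ratio x g c2 \<alpha> k \<omega>) b"
    using descent_trajectory[OF assms(2)] by blast
  then interpret t: descent_trajectory "\<lambda>k. x k \<omega>" S g h c1 c2 \<alpha> "\<lambda>k. step_ratio x g c2 \<alpha> k \<omega>" b .
  have gap: "t.gap k = h (x k \<omega>) - h_limit x h \<omega>" for k
    by (simp add: t.gap_def t.h_inf_def h_limit_def)
  show "?xs \<omega> \<in> zero_set S g \<and> (\<lambda>k. x k \<omega>) \<longlonglongrightarrow> ?xs \<omega> \<and>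
      (integrable_near_0 (\<eta> (?xs \<omega>)) (\<lambda>s. 1 / \<phi> (?xs \<omega>) s) \<longrightarrow>
        (\<exists>K. \<forall>k\<ge>K. x k \<omega> = x K \<omega>)) \<and>
      (\<not> integrable_near_0 (\<eta> (?xs \<omega>)) (\<lambda>s. 1 / \<phi> (?xs \<omega>) s) \<longrightarrow>
        (\<exists>K>0. \<forall>k\<ge>K.
          (let \<rho> = Psi_inv (\<eta> (?xs \<omega>)) (\<phi> (?xs \<omega>)) (t0 (?xs \<omega>))
                     (ereal (c1 * c2 / 2 * stepsize_sum \<alpha> k))
           in h (x k \<omega>) - h_limit x h \<omega> \<le> \<rho> \<and>
              norm (x k \<omega> - ?xs \<omega>) \<le> sqrt 2 / (c1 * sqrt c2) * Phi (\<phi> (?xs \<omega>)) \<rho>)))"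
  proof (rule t.convergence_and_rates[OF assms(3-5)])
    fix y
    assume y: "y \<in> zero_set S g" "(\<lambda>k. x k \<omega>) \<longlonglongrightarrow> y"
      and "integrable_near_0 (\<eta> y) (\<lambda>s. 1 / \<phi> y s) \<Longrightarrow> \<exists>K. \<forall>k\<ge>K. x k \<omega> = x K \<omega>"
      and rates: "\<not> integrable_near_0 (\<eta> y) (\<lambda>s. 1 / \<phi> y s) \<Longrightarrow>
        \<forall>\<^sub>F k in sequentially.
          t.gap k \<le> Psi_inv (\<eta> y) (\<phi> y) (t0 y) (ereal (c1 * c2 / 2 * stepsize_sum \<alpha> k)) \<and>
          norm (x k \<omega> - y) \<le> sqrt 2 / (c1 * sqrt c2) *
            Phi (\<phi> y) (Psi_inv (\<eta> y) (\<phi> y) (t0 y) (ereal (c1 * c2 / 2 * stepsize_sum \<alpha> k)))"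
    \<comment> \<open>Passing from a threshold to its successor makes the index positive.\<close>
    moreover have "\<exists>K>0. \<forall>k\<ge>K. P k" if "\<forall>\<^sub>F k in sequentially. P k" for P :: "nat \<Rightarrow> bool"
      using that unfolding eventually_sequentially by (metis Suc_leD zero_less_Suc)
    ultimately show ?thesis
      unfolding limI[OF y(2)] gap Let_def by blast
  qed
qed

end
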